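(* Let $b$ and $c$ be positive integers and let $e$ be their greatest common divisor. Put $M=\frac{b+c}{e}$. (a) If $M$ is a power of $2$, then there exists a perfect $2$-coloring of $H(N,2)$ without non-essential arguments and with quotient matrix $$\begin{pmatrix} N-b & b\\ c & N-c\end{pmatrix},$$ where $N=(2M-1)2^{e-1}-M$. (b) Moreover, if additionally $M\ge 8$ is an odd power of $2$ (i.e., $M=2^m$ with $m$ odd), then the same holds with $N=M\cdot 2^{e}-M$; that is, there exists a perfect $2$-coloring of $H(N,2)$ without non-essential arguments and with quotient matrix $\begin{pmatrix} N-b & b\\ c & N-c\end{pmatrix}$, where $N=M\cdot 2^e-M$.
   Context: The Hamming graph $H(n,q)$ is the graph on the set $\Sigma^n$ of words of length $n$ over an alphabet $\Sigma$ of size $q$, two words being adjacent if and only if they differ in exactly one position (so $H(N,2)$ is the $N$-dimensional hypercube). A $k$-coloring of a graph is a surjective function from its vertex set onto a finite set $K$ of $k$ colors. A $k$-coloring is perfect if there is a $k\times k$ matrix $(S_{i,j})_{i,j\in K}$ (the quotient matrix) such that every vertex of color $i$ has exactly $S_{i,j}$ neighbors of color $j$, for all $i,j\in K$. For a $2$-coloring, the rows and columns of the $2\times 2$ matrix are indexed by the two colors in a fixed order. A function $f$ on the vertices of $H(n,q)$ depends on its $i$th argument essentially if there are two vertices $\bar x,\bar y$ differing in only the $i$th position such that $f(\bar x)\ne f(\bar y)$, and non-essentially otherwise. "Without non-essential arguments" means that the function depends essentially on each of its arguments. *)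

theory Defs
  imports Complex_Main "Graph_Theory.Pair_Digraph"
begin

definition words :: "nat \<Rightarrow> nat \<Rightarrow> nat list set" where
  "words n q = {x. length x = n \<and> set x \<subseteq> {..<q}}"

(* An undirected graph is a symmetric digraph: each edge contributes both of its orientations. *)
definition hamming_graph :: "nat \<Rightarrow> nat \<Rightarrow> nat list pair_pre_digraph" where
  "hamming_graph n q =
     \<lparr> pverts = words n q,
       parcs = {(x, y). x \<in> words n q \<and> y \<in> words n q \<and> card {i. i < n \<and> x ! i \<noteq> y ! i} = 1} \<rparr>"

lemma pair_graph_hamming_graph: "pair_graph (hamming_graph n q)"
proof -
  have fin: "finite (words n q)"
    unfolding words_def using finite_lists_length_eq[of "{..<q}" n] by (simp add: conj_commute)
  have "parcs (hamming_graph n q) \<subseteq> words n q \<times> words n q"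
    by (auto simp: hamming_graph_def)
  with fin have fin': "finite (parcs (hamming_graph n q))"
    by (meson finite_SigmaI finite_subset)
  have "{i. i < n \<and> y ! i \<noteq> x ! i} = {i. i < n \<and> x ! i \<noteq> y ! i}" for x y :: "nat list"
    by metis
  then have "sym (parcs (hamming_graph n q))"
    by (simp add: hamming_graph_def sym_def)
  then have "symmetric (with_proj (hamming_graph n q))"
    by (simp add: symmetric_def)
  with fin fin' show ?thesis
    by unfold_locales (auto simp: hamming_graph_def)
qed

(* A coloring of G with color set K that is perfect with quotient matrix S. Matrix entries are
   integers, so that they can be written with subtraction; they are indexed by the colors. *)
definition perfect_coloring ::
    "'v pair_pre_digraph \<Rightarrow> 'c set \<Rightarrow> ('v \<Rightarrow> 'c) \<Rightarrow> ('c \<Rightarrow> 'c \<Rightarrow> int) \<Rightarrow> bool" where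
  "perfect_coloring G K f S \<longleftrightarrow>
     finite K \<and> f ` pverts G = K \<and>
     (\<forall>i\<in>K. \<forall>j\<in>K. \<forall>x\<in>pverts G. f x = i \<longrightarrow>
        int (card {y. (x, y) \<in> parcs G \<and> f y = j}) = S i j)"

(* Positions are numbered 0, ..., n - 1. *)
definition depends_essentially :: "nat \<Rightarrow> nat \<Rightarrow> (nat list \<Rightarrow> 'c) \<Rightarrow> nat \<Rightarrow> bool" where
  "depends_essentially n q f i \<longleftrightarrow>
     (\<exists>x\<in>words n q. \<exists>y\<in>words n q. {j. j < n \<and> x ! j \<noteq> y ! j} = {i} \<and> f x \<noteq> f y)"

definition without_nonessential_arguments :: "nat \<Rightarrow> nat \<Rightarrow> (nat list \<Rightarrow> 'c) \<Rightarrow> bool" where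
  "without_nonessential_arguments n q f \<longleftrightarrow> (\<forall>i<n. depends_essentially n q f i)"

(* The 2x2 matrix with rows (a, b) and (c, d), indexed by the colors 0 and 1. *)
definition matrix2 :: "int \<Rightarrow> int \<Rightarrow> int \<Rightarrow> int \<Rightarrow> nat \<Rightarrow> nat \<Rightarrow> int" where
  "matrix2 a b c d i j = [[a, b], [c, d]] ! i ! j"

end

theory Submission
  imports Defs
begin

text \<open>
  Write \<open>M = 2 ^ m\<close> and identify the numbers below \<open>M\<close> with the group \<open>\<int>\<^sub>2\<^sup>m\<close> under \<open>XOR\<close>.
  If \<open>F\<close> colors the vertices of a hypercube by this group so that every vertex has exactly \<open>e\<close>
  neighbors of each color other than its own, then merging \<open>b / e\<close> of the \<open>M\<close> colors gives the required
  quotient matrix. As \<open>b / e\<close> is odd, no such set of colors is invariant under a nonzero translation.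
  For \<open>e = 1\<close> take the syndrome of the Hamming code in dimension \<open>M - 1\<close> or, in dimension \<open>M \<ge> 8\<close>,
  two extended Hamming syndromes, one on the even words and one on the odd words, whose coordinates are
  labelled by group elements in ways that are not affinely equivalent. From \<open>F\<close> in dimension \<open>N\<close>, the coloring
  \<open>s(z) XOR F(x)\<close> for even \<open>z\<close>, \<open>s(z) XOR F(y)\<close> for odd \<open>z\<close>, where \<open>z\<close> has length \<open>M\<close> and
  extended syndrome \<open>s(z)\<close>, has dimension \<open>2 N + M\<close> and parameter \<open>e + 1\<close>.
\<close>

unbundle bit_operations_syntax

section \<open>Syndromes and translations of the color group\<close>

definition flip :: "nat \<Rightarrow> (nat \<Rightarrow> bool) \<Rightarrow> nat \<Rightarrow> bool" where
  "flip i x = x(i := \<not> x i)"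

lemma flip_apply: "flip i x j = (if j = i then \<not> x i else x j)"
  by (simp add: flip_def)

text \<open>The labels \<open>h i\<close> are the columns of a parity check matrix.
  \<open>h = Suc\<close> gives the Hamming code; \<open>h = id\<close>, taken together with the
  parity, gives the extended Hamming code.\<close>

primrec syndrome :: "(nat \<Rightarrow> nat) \<Rightarrow> nat \<Rightarrow> (nat \<Rightarrow> bool) \<Rightarrow> nat" where
  "syndrome h 0 x = 0"
| "syndrome h (Suc n) x = syndrome h n x XOR (if x n then h n else 0)"

text \<open>Weight modulo 2 is the syndrome for constant label 1, so it shares all flip
  lemmas.\<close>

abbreviation parity :: "nat \<Rightarrow> (nat \<Rightarrow> bool) \<Rightarrow> nat" where
  "parity \<equiv> syndrome (\<lambda>_. 1)"

lemma xor_less_power2: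
  fixes u v :: nat
  assumes "u < 2 ^ m" "v < 2 ^ m"
  shows "u XOR v < 2 ^ m"
  using assms by (simp flip: take_bit_nat_eq_self_iff)

lemma xor_cancel_left [simp]: "u XOR (u XOR v) = v" for u v :: nat
  by (simp flip: xor.assoc)

lemma xor_eq_iff: "u XOR v = w \<longleftrightarrow> v = u XOR w" for u v w :: nat
  by (metis xor_cancel_left)

lemma syndrome_cong: "(\<And>i. i < n \<Longrightarrow> x i = y i) \<Longrightarrow> syndrome h n x = syndrome h n y"
  by (induction n) simp_all

lemma syndrome_flip_ge: "n \<le> i \<Longrightarrow> syndrome h n (flip i x) = syndrome h n x"
  by (rule syndrome_cong) (simp add: flip_def)

lemma syndrome_flip: "i < n \<Longrightarrow> syndrome h n (flip i x) = syndrome h n x XOR h i"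
proof (induction n)
  case (Suc n)
  show ?case
  proof (cases "i = n")
    case True
    have "syndrome h n (flip n x) = syndrome h n x"
      by (rule syndrome_flip_ge) simp
    moreover have "flip n x n \<longleftrightarrow> \<not> x n"
      by (simp add: flip_apply)
    ultimately show ?thesis
      using True by (simp add: xor.assoc)
  next
    case False
    with Suc have "syndrome h n (flip i x) = syndrome h n x XOR h i" by simp
    moreover have "flip i x n = x n"
      using False by (simp add: flip_apply)
    ultimately show ?thesis
      by (simp add: xor.assoc xor.commute[of "h i"])
  qed
qed simp

lemma syndrome_False [simp]: "syndrome h n (\<lambda>_. False) = 0"
  by (induction n) simp_all

lemma syndrome_less: "(\<And>i. i < n \<Longrightarrow> h i < 2 ^ m) \<Longrightarrow> syndrome h n x < 2 ^ m"
  by (induction n) (auto intro!: xor_less_power2)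

lemma parity_eq_0_or_1: "parity n x = 0 \<or> parity n x = 1"
  using syndrome_less[of n "\<lambda>_. 1" 1 x] by auto

text \<open>If \<open>k\<close> is a bit set in \<open>t\<close>, translation by \<open>t\<close>
  exchanges the elements with bit \<open>k\<close> and those without it. A translation-invariant set
  therefore splits into two halves of equal size. This is what makes arguments essential after an
  odd number of colors is merged.\<close>

lemma odd_card_not_xor_invariant:
  fixes B :: "nat set"
  assumes "finite B" "odd (card B)" "t \<noteq> 0" "B \<subseteq> {..<2 ^ m}" "t < 2 ^ m"
  obtains v where "v < 2 ^ m" "(v \<in> B) \<noteq> (v XOR t \<in> B)"
proof (rule ccontr)
  assume "\<not> thesis"
  with that assms have inv: "v XOR t \<in> B" if "v \<in> B" for v
    using that by blast
  from \<open>t \<noteq> 0\<close> obtain k where k: "bit t k"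
    by (metis bit_eq_iff bit_0_eq bot_apply bot_bool_def)
  have "bij_betw (\<lambda>v. v XOR t) {v \<in> B. bit v k} {v \<in> B. \<not> bit v k}"
    by (rule bij_betw_byWitness[where f' = "\<lambda>v. v XOR t"])
      (use inv k in \<open>auto simp: bit_xor_iff xor.assoc\<close>)
  then have "card {v \<in> B. bit v k} = card {v \<in> B. \<not> bit v k}"
    by (rule bij_betw_same_card)
  moreover have "card B = card {v \<in> B. bit v k} + card {v \<in> B. \<not> bit v k}"
    using \<open>finite B\<close> by (subst card_Un_disjoint[symmetric]) (auto intro: arg_cong[where f = card])
  ultimately show False
    using \<open>odd (card B)\<close> by simp
qed

text \<open>Cuts a count of positions at a block boundary; applied twice, it separates the three
  blocks of a composite word.\<close>

lemma card_less_add_split: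
  "card {i. i < a + b \<and> P i} = card {i. i < a \<and> P i} + card {i. i < b \<and> P (a + i)}" for a b :: nat
proof -
  have "{i. i < a + b \<and> P i} = {i. i < a \<and> P i} \<union> (+) a ` {i. i < b \<and> P (a + i)}"
    by (auto simp: image_iff) (metis add_diff_inverse_nat nat_add_left_cancel_less)
  moreover have "{i. i < a \<and> P i} \<inter> (+) a ` {i. i < b \<and> P (a + i)} = {}"
    by auto
  ultimately show ?thesis
    by (simp add: card_Un_disjoint card_image)
qed

section \<open>Uniform colorings\<close>

text \<open>A word of length \<open>n\<close> is represented by a function of which only the first \<open>n\<close> values matter.\<close>
definition uniform_coloring :: "nat \<Rightarrow> nat \<Rightarrow> nat \<Rightarrow> ((nat \<Rightarrow> bool) \<Rightarrow> nat) \<Rightarrow> bool" where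
  "uniform_coloring m n e F \<longleftrightarrow>
     (\<forall>x y. (\<forall>i<n. x i = y i) \<longrightarrow> F x = F y) \<and>
     (\<forall>x. F x < 2 ^ m) \<and>
     (\<forall>x u. u < 2 ^ m \<longrightarrow> u \<noteq> F x \<longrightarrow> card {i. i < n \<and> F (flip i x) = u} = e) \<and>
     (\<forall>i<n. \<forall>B\<subseteq>{..<2 ^ m}. odd (card B) \<longrightarrow> (\<exists>x. (F x \<in> B) \<noteq> (F (flip i x) \<in> B)))"

lemma uniform_coloring_card:
  "uniform_coloring m n e F \<Longrightarrow> u < 2 ^ m \<Longrightarrow> u \<noteq> F x
    \<Longrightarrow> card {i. i < n \<and> F (flip i x) = u} = e"
  unfolding uniform_coloring_def by blast

lemma uniform_coloring_essential:
  assumes "uniform_coloring m n e F" "i < n" "B \<subseteq> {..<2 ^ m}" "odd (card B)"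
  obtains x where "(F x \<in> B) \<noteq> (F (flip i x) \<in> B)"
  using assms unfolding uniform_coloring_def by blast

text \<open>The zero word together with its neighbors already shows every color, since each color
  other than its own occurs \<open>e > 0\<close> times around it.\<close>

lemma uniform_coloring_surj:
  assumes "uniform_coloring m n e F" "e > 0" "u < 2 ^ m"
  obtains x where "F x = u"
proof (cases "F (\<lambda>_. False) = u")
  case False
  with assms have "card {i. i < n \<and> F (flip i (\<lambda>_. False)) = u} \<noteq> 0"
    by (auto simp: uniform_coloring_def)
  then have "{i. i < n \<and> F (flip i (\<lambda>_. False)) = u} \<noteq> {}"
    by (metis card.empty)
  then show ?thesis
    using that by blast
qed (use that in blast)

section \<open>Base colorings with parameter 1\<close>

text \<open>Flipping position \<open>i\<close> translates the color by \<open>Suc i\<close>, and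
  these labels run once through all nonzero group elements.\<close>

lemma uniform_coloring_hamming: "uniform_coloring m (2 ^ m - 1) 1 (syndrome Suc (2 ^ m - 1))"
  unfolding uniform_coloring_def
proof (intro conjI allI impI)
  let ?n = "2 ^ m - 1 :: nat"
  let ?F = "syndrome Suc ?n"
  fix x y :: "nat \<Rightarrow> bool" assume "\<forall>i<?n. x i = y i"
  then show "?F x = ?F y" by (intro syndrome_cong) blast
next
  fix x show "syndrome Suc (2 ^ m - 1) x < 2 ^ m"
    by (rule syndrome_less) linarith
next
  let ?n = "2 ^ m - 1 :: nat"
  let ?F = "syndrome Suc ?n"
  fix x :: "nat \<Rightarrow> bool" and u :: nat assume u: "u < 2 ^ m" "u \<noteq> ?F x"
  have "?F x < 2 ^ m"
    by (rule syndrome_less) linarith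
  with u have t: "?F x XOR u < 2 ^ m" "?F x XOR u \<noteq> 0"
    by (auto simp: xor_less_power2 xor_eq_iff)
  have "{i. i < ?n \<and> ?F (flip i x) = u} = {i. i < ?n \<and> Suc i = ?F x XOR u}"
    by (auto simp: syndrome_flip xor_eq_iff)
  also have "\<dots> = {(?F x XOR u) - 1}"
    using t by auto
  finally show "card {i. i < ?n \<and> ?F (flip i x) = u} = 1" by simp
next
  let ?n = "2 ^ m - 1 :: nat"
  let ?F = "syndrome Suc ?n"
  fix i B assume i: "i < ?n" and B: "B \<subseteq> {..<2 ^ m :: nat}" "odd (card B)"
  have fin: "finite B" using B(1) finite_subset by blast
  have Suc_i: "Suc i < 2 ^ m" "Suc i \<noteq> 0" using i by linarith+
  obtain v where v: "v < 2 ^ m" "(v \<in> B) \<noteq> (v XOR Suc i \<in> B)"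
    using odd_card_not_xor_invariant[OF fin B(2) _ B(1), of "Suc i"] Suc_i by blast
  \<comment> \<open>Words of weight at most 1 realize every color: position \<open>v - 1\<close>
    carries the label \<open>v\<close>.\<close>
  have "\<exists>x. ?F x = v"
  proof (cases "v = 0")
    case True
    then show ?thesis by (intro exI[of _ "\<lambda>_. False"]) simp
  next
    case False
    with v(1) show ?thesis
      by (intro exI[of _ "flip (v - 1) (\<lambda>_. False)"]) (auto simp: syndrome_flip)
  qed
  then obtain x where "?F x = v" ..
  with i v show "\<exists>x. (?F x \<in> B) \<noteq> (?F (flip i x) \<in> B)"
    by (intro exI[of _ x]) (simp add: syndrome_flip)
qed

text \<open>A flip changes the parity, so all neighbors of a word are colored by the other
  labelling, which is a bijection onto the group: each color occurs exactly once among them. The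
  transposition \<open>p\<close> of 0 and 4 is not affine, so two even words can agree in the
  \<open>id\<close> syndrome and differ by 4 in the \<open>p\<close> syndrome. They have the same
  color, but flipping \<open>i\<close> leads to colors \<open>v\<close> and \<open>v XOR 4\<close>,
  of which only one lies in \<open>B\<close>. With only four labels every permutation is affine,
  hence \<open>m \<ge> 3\<close>.\<close>

lemma uniform_coloring_twisted:
  assumes m: "m \<ge> 3"
  defines "n \<equiv> 2 ^ m"
  defines "p \<equiv> \<lambda>i::nat. if i = 0 then 4 else if i = 4 then 0 else i"
  shows "uniform_coloring m n 1 (\<lambda>x. if parity n x = 0 then syndrome id n x else syndrome p n x)"
    (is "uniform_coloring m n 1 ?F")
proof -
  have n: "n \<ge> 8"
    using power_increasing[OF m, of "2::nat"] by (simp add: n_def)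
  have p_less: "p i < 2 ^ m" if "i < n" for i
    using that n by (auto simp: p_def n_def)
  have p_inv: "p (p i) = i" for i
    by (simp add: p_def)
  have less: "syndrome id n x < 2 ^ m" "syndrome p n x < 2 ^ m" for x
    by (rule syndrome_less; use p_less in \<open>simp add: n_def\<close>)+
  have count: "card {i. i < n \<and> a XOR p i = u} = 1" "card {i. i < n \<and> a XOR i = u} = 1"
    if "a < 2 ^ m" "u < 2 ^ m" for a u
  proof -
    have t: "a XOR u < n" using that by (simp add: xor_less_power2 n_def)
    have "{i. i < n \<and> a XOR p i = u} = {p (a XOR u)}"
      using p_less[OF t] by (auto simp: xor_eq_iff n_def) (metis p_inv)+
    then show "card {i. i < n \<and> a XOR p i = u} = 1" by simp
    have "{i. i < n \<and> a XOR i = u} = {a XOR u}"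
      using t by (auto simp: xor_eq_iff)
    then show "card {i. i < n \<and> a XOR i = u} = 1" by simp
  qed
  show ?thesis
    unfolding uniform_coloring_def
  proof (intro conjI allI impI)
    fix x y :: "nat \<Rightarrow> bool" assume "\<forall>i<n. x i = y i"
    then have "syndrome h n x = syndrome h n y" for h by (intro syndrome_cong) blast
    then show "?F x = ?F y" by simp
  next
    fix x show "?F x < 2 ^ m" using less by simp
  next
    fix x u assume u: "u < (2::nat) ^ m"
    show "card {i. i < n \<and> ?F (flip i x) = u} = 1"
    proof (cases "parity n x = 0")
      case True
      then have "{i. i < n \<and> ?F (flip i x) = u} = {i. i < n \<and> syndrome p n x XOR p i = u}"
        by (auto simp: syndrome_flip)
      then show ?thesis using count(1)[OF less(2) u] by metis
    next
      case False
      then have "parity n x = 1" using parity_eq_0_or_1[of n x] by simp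
      then have "{i. i < n \<and> ?F (flip i x) = u} = {i. i < n \<and> syndrome id n x XOR i = u}"
        by (auto simp: syndrome_flip)
      then show ?thesis using count(2)[OF less(1) u] by metis
    qed
  next
    fix i B assume i: "i < n" and B: "B \<subseteq> {..<2 ^ m :: nat}" "odd (card B)"
    have fin: "finite B" using B(1) finite_subset by blast
    have "(4::nat) < 2 ^ m" using n by (simp add: n_def)
    then obtain v where v: "v < 2 ^ m" "(v \<in> B) \<noteq> (v XOR 4 \<in> B)"
      using odd_card_not_xor_invariant[OF fin B(2) _ B(1), of 4] by auto
    define t where "t = v XOR p i"
    \<comment> \<open>An even word with \<open>p\<close> syndrome \<open>t\<close> gets the color
      \<open>v\<close> when position \<open>i\<close> is flipped.\<close>
    have t: "p t < n" "t < n"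
      using p_less[OF i] v(1) p_less[of t] by (auto simp: t_def xor_less_power2 n_def)
    \<comment> \<open>Position \<open>p t\<close> has the \<open>p\<close> label \<open>t\<close>.
      Position 4 has the \<open>p\<close> label 0 and only restores even parity; for
      \<open>t = 0\<close> the two flips cancel.\<close>
    define x where "x = flip 4 (flip (p t) (\<lambda>_. False))"
    have x: "parity n x = 0" "syndrome p n x = t"
      using n t p_inv by (simp_all add: x_def syndrome_flip p_def)
    define y where "y = flip 0 (flip 1 (flip 2 (flip 3 x)))"
    \<comment> \<open>The four flipped positions sum to \<open>0\<close>, but their images under \<open>p\<close> sum to \<open>4\<close>.\<close>
    have y: "parity n y = 0" "syndrome id n y = syndrome id n x" "syndrome p n y = t XOR 4"
      using n x by (simp_all add: y_def syndrome_flip p_def xor.assoc)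
    have "?F (flip i x) = v" "?F (flip i y) = v XOR 4" "?F x = ?F y"
      using x y i by (simp_all add: syndrome_flip t_def xor.assoc xor.commute xor.left_commute)
    with v(2) show "\<exists>x. (?F x \<in> B) \<noteq> (?F (flip i x) \<in> B)" by metis
  qed
qed

section \<open>Raising the parameter by one\<close>

text \<open>The parity of the first block selects which of the blocks \<open>X\<close> and
  \<open>Y\<close> is active. Flips in the first block switch the active block and produce every
  color exactly once; flips in the active block produce every color but the present one
  \<open>e\<close> times; flips in the inactive block change nothing. Together this gives
  \<open>e + 1\<close>.\<close>

lemma uniform_coloring_step:
  assumes F: "uniform_coloring m n e F" and e: "e > 0" and m: "m > 0"
  defines "M \<equiv> 2 ^ m"
  defines "X \<equiv> \<lambda>x::nat \<Rightarrow> bool. \<lambda>i. x (M + i)"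
    and "Y \<equiv> \<lambda>x::nat \<Rightarrow> bool. \<lambda>i. x (M + n + i)"
  defines "G \<equiv> \<lambda>x. syndrome id M x XOR F (if parity M x = 0 then X x else Y x)"
  shows "uniform_coloring m (M + n + n) (Suc e) G"
proof -
  have F_cong: "F x = F y" if "\<And>i. i < n \<Longrightarrow> x i = y i" for x y
    using F that unfolding uniform_coloring_def by blast
  have F_less: "F x < 2 ^ m" for x
    using F unfolding uniform_coloring_def by blast
  have F_count: "card {i. i < n \<and> F (flip i x) = u} = e" if "u < 2 ^ m" "u \<noteq> F x" for x u
    using uniform_coloring_card[OF F] that by blast
  have s_less: "syndrome id M x < 2 ^ m" for x
    by (rule syndrome_less) (simp add: M_def)
  have M: "M > 0" by (simp add: M_def)
  have X_flip: "X (flip (M + i) x) = flip i (X x)" for i x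
    by (auto simp: X_def flip_def fun_eq_iff)
  have Y_flip: "Y (flip (M + n + i) x) = flip i (Y x)" for i x
    by (auto simp: Y_def flip_def fun_eq_iff)
  \<comment> \<open>\<open>X x\<close> is not truncated: beyond its first \<open>n\<close> values it
    runs into the block of \<open>Y\<close>, so equality holds only after applying
    \<open>F\<close>.\<close>
  have FX_flip: "F (X (flip (M + n + i) x)) = F (X x)" for i x
    by (rule F_cong) (simp add: X_def flip_def)
  have Y_flip': "Y (flip (M + i) x) = Y x" if "i < n" for i x
    using that by (auto simp: Y_def flip_def fun_eq_iff)
  have XY_flip: "X (flip i x) = X x" "Y (flip i x) = Y x" if "i < M" for i x
    using that by (auto simp: X_def Y_def flip_def fun_eq_iff)
  have s_flip: "syndrome h M (flip (M + i) x) = syndrome h M x"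
    "syndrome h M (flip (M + n + i) x) = syndrome h M x" for h i x
    by (simp_all add: syndrome_flip_ge)
  \<comment> \<open>The three blocks can be prescribed independently. The words \<open>a\<close> and
    \<open>b\<close> are matched only on \<open>n\<close> positions, so the conclusions are stated
    through \<open>F\<close>.\<close>
  have cat: thesis
    if "\<And>x. (\<And>h. syndrome h M x = syndrome h M z) \<Longrightarrow> F (X x) = F a \<Longrightarrow> F (Y x) = F b
        \<Longrightarrow> (\<And>i. F (flip i (X x)) = F (flip i a)) \<Longrightarrow> (\<And>i. F (flip i (Y x)) = F (flip i b))
        \<Longrightarrow> thesis" for z a b thesis
  proof -
    define x where "x j = (if j < M then z j else if j < M + n then a (j - M) else b (j - M - n))" for j
    show thesis
      by (rule that[of x])
        (auto intro!: syndrome_cong F_cong simp: x_def X_def Y_def flip_apply)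
  qed
  show ?thesis
    unfolding uniform_coloring_def
  proof (intro conjI allI impI)
    fix x y :: "nat \<Rightarrow> bool" assume "\<forall>i<M + n + n. x i = y i"
    then have "syndrome h M x = syndrome h M y" "F (X x) = F (X y)" "F (Y x) = F (Y y)" for h
      by (auto intro!: syndrome_cong F_cong simp: X_def Y_def)
    then show "G x = G y" by (simp add: G_def)
  next
    fix x show "G x < 2 ^ m"
      unfolding G_def by (intro xor_less_power2 s_less F_less)
  next
    fix x u assume u: "u < (2::nat) ^ m" "u \<noteq> G x"
    let ?s = "syndrome id M x"
    have su: "?s XOR u < 2 ^ m" using u s_less by (simp add: xor_less_power2)
    have one: "card {i. i < M \<and> ?s XOR i XOR a = u} = 1" if "a < 2 ^ m" for a
    proof -
      have "{i. i < M \<and> ?s XOR i XOR a = u} = {a XOR (?s XOR u)}"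
        using that su by (auto simp: xor_eq_iff xor.commute[of _ a] M_def xor_less_power2)
      then show ?thesis by simp
    qed
    show "card {i. i < M + n + n \<and> G (flip i x) = u} = Suc e"
    proof (cases "parity M x = 0")
      case True
      have "{i. i < M \<and> G (flip i x) = u} = {i. i < M \<and> ?s XOR i XOR F (Y x) = u}"
        using True by (auto simp: G_def syndrome_flip XY_flip xor.assoc)
      moreover have "{i. i < n \<and> G (flip (M + i) x) = u}
          = {i. i < n \<and> F (flip i (X x)) = ?s XOR u}"
        using True by (auto simp: G_def s_flip X_flip xor_eq_iff)
      moreover have "{i. i < n \<and> G (flip (M + n + i) x) = u} = {}"
        using True u by (auto simp: G_def s_flip FX_flip)
      moreover have "?s XOR u \<noteq> F (X x)"
        using True u by (auto simp: G_def xor_eq_iff)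
      ultimately show ?thesis
        by (simp add: card_less_add_split one F_less F_count su)
    next
      case False
      then have p: "parity M x = 1" using parity_eq_0_or_1[of M x] by simp
      have "{i. i < M \<and> G (flip i x) = u} = {i. i < M \<and> ?s XOR i XOR F (X x) = u}"
        using p by (auto simp: G_def syndrome_flip XY_flip xor.assoc)
      moreover have "{i. i < n \<and> G (flip (M + n + i) x) = u}
          = {i. i < n \<and> F (flip i (Y x)) = ?s XOR u}"
        using p by (auto simp: G_def s_flip Y_flip xor_eq_iff)
      moreover have "{i. i < n \<and> G (flip (M + i) x) = u} = {}"
        using p u by (auto simp: G_def s_flip Y_flip')
      moreover have "?s XOR u \<noteq> F (Y x)"
        using p u by (auto simp: G_def xor_eq_iff)
      ultimately show ?thesis
        by (simp add: card_less_add_split one F_less F_count su)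
    qed
  next
    fix i B assume i: "i < M + n + n" and B: "B \<subseteq> {..<2 ^ m :: nat}" "odd (card B)"
    show "\<exists>x. (G x \<in> B) \<noteq> (G (flip i x) \<in> B)"
    proof -
      consider "i < M" | k where "k < n" "i = M + k" | k where "k < n" "i = M + n + k"
      proof -
        have "i < M \<or> (\<exists>k<n. i = M + k) \<or> (\<exists>k<n. i = M + n + k)"
          using i by presburger
        then show thesis using that by blast
      qed
      then show ?thesis
      proof cases
        case 1
        \<comment> \<open>Since \<open>2 ^ m\<close> is even, \<open>B\<close> is neither empty nor
          everything. A flip at \<open>i\<close> in the zero first block hands over from
          \<open>X\<close> to \<open>Y\<close>, whose colors are free: \<open>v\<close> in
          \<open>B\<close> before, and \<open>i XOR (i XOR w) = w\<close> outside \<open>B\<close>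
          after.\<close>
        have "B \<noteq> {}" using B(2) by auto
        then obtain v where v: "v \<in> B" "v < 2 ^ m" using B(1) by auto
        have "B \<noteq> {..<2 ^ m}" using B(2) m by auto
        with B(1) have "\<exists>w<2 ^ m. w \<notin> B" by auto
        then obtain w where w: "w \<notin> B" "w < 2 ^ m" by blast
        have iw: "i XOR w < 2 ^ m" using 1 w by (simp add: xor_less_power2 M_def)
        obtain a where a: "F a = v" using uniform_coloring_surj[OF F e v(2)] .
        obtain b where b: "F b = i XOR w" using uniform_coloring_surj[OF F e iw] .
        obtain x where "syndrome id M x = 0" "parity M x = 0" "F (X x) = v" "F (Y x) = i XOR w"
          by (rule cat[of "\<lambda>_. False" a b], rule that) (use a b in simp_all)
        then have "G x = v" "G (flip i x) = w"
          using 1 by (simp_all add: G_def syndrome_flip XY_flip)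
        then show ?thesis using v(1) w(1) by metis
      next
        case 2
        obtain a where a: "(F a \<in> B) \<noteq> (F (flip k a) \<in> B)"
          using uniform_coloring_essential[OF F \<open>k < n\<close> B] .
        obtain x where "syndrome id M x = 0" "parity M x = 0" "F (X x) = F a" "F (flip k (X x)) = F (flip k a)"
          by (rule cat[of "\<lambda>_. False" a a], rule that) simp_all
        then have "G x = F a" "G (flip i x) = F (flip k a)"
          using 2 by (simp_all add: G_def s_flip X_flip)
        then show ?thesis using a by metis
      next
        case 3
        obtain a where a: "(F a \<in> B) \<noteq> (F (flip k a) \<in> B)"
          using uniform_coloring_essential[OF F \<open>k < n\<close> B] .
        \<comment> \<open>Position 0 has label 0: setting it makes \<open>Y\<close> active and keeps
          the syndrome 0.\<close>
        obtain x where "syndrome id M x = 0" "parity M x = 1"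
          "F (Y x) = F a" "F (flip k (Y x)) = F (flip k a)"
          by (rule cat[of "flip 0 (\<lambda>_. False)" a a], rule that) (use M in \<open>simp_all add: syndrome_flip\<close>)
        then have "G x = F a" "G (flip i x) = F (flip k a)"
          using 3 by (simp_all add: G_def s_flip Y_flip)
        then show ?thesis using a by metis
      qed
    qed
  qed
qed

text \<open>One step takes \<open>k\<close> to \<open>2 * k + 2 ^ m\<close>, which doubles
  \<open>k + 2 ^ m\<close>.\<close>

lemma uniform_coloring_iterate:
  assumes "uniform_coloring m n 1 F" "m > 0" "e > 0"
  shows "\<exists>k G. uniform_coloring m k e G \<and> k + 2 ^ m = (n + 2 ^ m) * 2 ^ (e - 1)"
  using \<open>e > 0\<close>
proof (induction e rule: nat_induct_non_zero)
  case 1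
  with assms(1) show ?case by auto
next
  case (Suc e)
  then obtain k G where "uniform_coloring m k e G" "k + 2 ^ m = (n + 2 ^ m) * 2 ^ (e - 1)"
    by blast
  moreover have "2 ^ e = 2 * (2 ^ (e - 1) :: nat)"
    using \<open>e > 0\<close> by (simp flip: power_Suc)
  ultimately show ?case
    using uniform_coloring_step[of m k e G] \<open>m > 0\<close> \<open>e > 0\<close>
    by (intro exI[of _ "2 ^ m + k + k"]) (auto simp: algebra_simps)
qed

section \<open>From Boolean functions to words of the Hamming graph\<close>

text \<open>The bound on \<open>i\<close> fixes the value False past the end, so that updating a
  letter of \<open>w\<close> is exactly a \<open>flip\<close>, with equality of functions.\<close>

definition support :: "nat list \<Rightarrow> nat \<Rightarrow> bool" where
  "support w i \<longleftrightarrow> i < length w \<and> w ! i = 1"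

lemma words_2_nth: "w \<in> words n 2 \<Longrightarrow> i < n \<Longrightarrow> w ! i = 0 \<or> w ! i = 1"
  unfolding words_def using nth_mem[of i w] by fastforce

lemma support_flip:
  assumes "w \<in> words n 2" "i < n"
  shows "support (w[i := 1 - w ! i]) = flip i (support w)"
  using assms words_2_nth[OF assms]
  by (auto simp: support_def flip_def fun_eq_iff words_def nth_list_update)

lemma hamming_neighbors:
  assumes w: "w \<in> words n 2"
  shows "{y. (w, y) \<in> parcs (hamming_graph n 2)} = (\<lambda>i. w[i := 1 - w ! i]) ` {..<n}"
proof (intro equalityI subsetI)
  fix y assume "y \<in> {y. (w, y) \<in> parcs (hamming_graph n 2)}"
  then have y: "y \<in> words n 2" and "card {i. i < n \<and> w ! i \<noteq> y ! i} = 1"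
    by (auto simp: hamming_graph_def)
  then obtain i where i: "{i. i < n \<and> w ! i \<noteq> y ! i} = {i}"
    using card_1_singletonE by blast
  then have "i < n" "w ! i \<noteq> y ! i" by auto
  moreover have "w ! j = y ! j" if "j < n" "j \<noteq> i" for j using i that by blast
  ultimately have "y = w[i := 1 - w ! i]"
    using w y words_2_nth[OF w, of i] words_2_nth[OF y, of i]
    by (intro nth_equalityI) (auto simp: words_def nth_list_update)
  then show "y \<in> (\<lambda>i. w[i := 1 - w ! i]) ` {..<n}" using \<open>i < n\<close> by blast
next
  fix y assume "y \<in> (\<lambda>i. w[i := 1 - w ! i]) ` {..<n}"
  then obtain i where i: "i < n" "y = w[i := 1 - w ! i]" by blast
  then have "{j. j < n \<and> w ! j \<noteq> y ! j} = {i}"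
    using w words_2_nth[OF w i(1)] by (auto simp: words_def nth_list_update)
  moreover have "y \<in> words n 2"
    using w i words_2_nth[OF w i(1)] set_update_subset_insert[of w i "1 - w ! i"]
    by (auto simp: words_def)
  ultimately show "y \<in> {y. (w, y) \<in> parcs (hamming_graph n 2)}"
    using w by (simp add: hamming_graph_def)
qed

text \<open>Neighbors correspond injectively to the flipped positions, so counting them becomes
  counting positions.\<close>

lemma card_hamming_neighbors:
  assumes w: "w \<in> words n 2"
  shows "card {y. (w, y) \<in> parcs (hamming_graph n 2) \<and> P (support y)}
    = card {i. i < n \<and> P (flip i (support w))}"
proof -
  let ?h = "\<lambda>i. w[i := 1 - w ! i]"
  have "{y. (w, y) \<in> parcs (hamming_graph n 2) \<and> P (support y)}
      = {y \<in> ?h ` {..<n}. P (support y)}"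
    using hamming_neighbors[OF w] by blast
  also have "\<dots> = ?h ` {i. i < n \<and> P (flip i (support w))}"
    using support_flip[OF w] by auto
  finally have "{y. (w, y) \<in> parcs (hamming_graph n 2) \<and> P (support y)}
      = ?h ` {i. i < n \<and> P (flip i (support w))}" .
  moreover have "inj_on ?h {..<n}"
  proof (rule inj_onI)
    fix i j assume ij: "i \<in> {..<n}" "j \<in> {..<n}" "?h i = ?h j"
    then have "?h i ! i = ?h j ! i" by simp
    with ij(1,2) w words_2_nth[OF w, of i] show "i = j"
      by (auto simp: words_def nth_list_update split: if_splits)
  qed
  ultimately show ?thesis
    by (metis (no_types, lifting) card_image inj_on_subset lessThan_iff mem_Collect_eq subsetI)
qed

section \<open>Merging colors\<close>

lemma uniform_coloring_card_preimage:
  assumes "uniform_coloring m n e F" "U \<subseteq> {..<2 ^ m}" "F x \<notin> U"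
  shows "card {i. i < n \<and> F (flip i x) \<in> U} = e * card U"
proof -
  have "finite U" using assms(2) finite_subset by blast
  have "{i. i < n \<and> F (flip i x) \<in> U} = (\<Union>u\<in>U. {i. i < n \<and> F (flip i x) = u})"
    by auto
  then have "card {i. i < n \<and> F (flip i x) \<in> U} = (\<Sum>u\<in>U. card {i. i < n \<and> F (flip i x) = u})"
    using \<open>finite U\<close> by (simp only:, subst card_UN_disjoint) auto
  also have "\<dots> = (\<Sum>u\<in>U. e)"
    using assms by (intro sum.cong uniform_coloring_card[OF assms(1)]) auto
  finally show ?thesis by simp
qed

text \<open>Here \<open>b\<close> and \<open>c\<close> stand for the reduced parameters. The
  off-diagonal entries count the merged colors, \<open>e\<close> neighbors for each; the diagonal
  ones follow from the degree \<open>n\<close>. Oddness of \<open>b\<close> makes every argument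
  essential.\<close>

lemma uniform_coloring_merge:
  assumes F: "uniform_coloring m n e F" and e: "e > 0"
    and b: "odd b" and bc: "b + c = 2 ^ m" "c > 0"
  shows "\<exists>f. perfect_coloring (hamming_graph n 2) {0, 1} f
      (matrix2 (int n - int (e * b)) (int (e * b)) (int (e * c)) (int n - int (e * c)))
    \<and> without_nonessential_arguments n 2 f"
proof -
  \<comment> \<open>The first \<open>b\<close> colors become color 1, so that a vertex of color 0
    sees \<open>e * b\<close> neighbors of color 1, as the first row demands.\<close>
  define f :: "nat list \<Rightarrow> nat" where "f w = of_bool (F (support w) < b)" for w
  have f_iff: "f w = Suc 0 \<longleftrightarrow> F (support w) < b" "f w = 0 \<longleftrightarrow> \<not> F (support w) < b" for w
    by (simp_all add: f_def)
  have F_less: "F x < 2 ^ m" for x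
    using F by (simp add: uniform_coloring_def)
  have F_cong: "F x = F y" if "\<And>i. i < n \<Longrightarrow> x i = y i" for x y
    using F that unfolding uniform_coloring_def by blast
  have word: "\<exists>w\<in>words n 2. \<forall>i<n. support w i = x i" for x
    by (intro bexI[of _ "map (\<lambda>i. of_bool (x i)) [0..<n]"]) (auto simp: support_def words_def)
  have up: "card {y. (w, y) \<in> parcs (hamming_graph n 2) \<and> F (support y) < b} = e * b"
    if "w \<in> words n 2" "\<not> F (support w) < b" for w
    using uniform_coloring_card_preimage[OF F, of "{..<b}" "support w"] that bc
    by (simp add: card_hamming_neighbors[of w n "\<lambda>x. F x < b"])
  have down: "card {y. (w, y) \<in> parcs (hamming_graph n 2) \<and> \<not> F (support y) < b} = e * c"
    if "w \<in> words n 2" "F (support w) < b" for w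
  proof -
    have "{i. i < n \<and> F (flip i (support w)) \<in> {b..<2 ^ m}}
        = {i. i < n \<and> \<not> F (flip i (support w)) < b}"
      using F_less by auto
    moreover have "card {b..<2 ^ m} = c" "{b..<2 ^ m} \<subseteq> {..<2 ^ m}" using bc by auto
    ultimately show ?thesis
      using uniform_coloring_card_preimage[OF F, of "{b..<2 ^ m}" "support w"] that
      by (simp add: card_hamming_neighbors[of w n "\<lambda>x. \<not> F x < b"])
  qed
  have total: "card {y. (w, y) \<in> parcs (hamming_graph n 2) \<and> F (support y) < b}
      + card {y. (w, y) \<in> parcs (hamming_graph n 2) \<and> \<not> F (support y) < b} = n"
    if w: "w \<in> words n 2" for w
  proof -
    have "card {i. i < n \<and> Q i} + card {i. i < n \<and> \<not> Q i} = n" for Q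
    proof -
      have "{i. i < n \<and> Q i} \<union> {i. i < n \<and> \<not> Q i} = {..<n}" by auto
      then show ?thesis
        by (subst card_Un_disjoint[symmetric]) auto
    qed
    then show ?thesis
      by (simp add: card_hamming_neighbors[OF w, of "\<lambda>x. F x < b"]
          card_hamming_neighbors[OF w, of "\<lambda>x. \<not> F x < b"])
  qed
  have "f ` words n 2 = {0, 1}"
  proof -
    have *: "\<exists>w\<in>words n 2. F (support w) = u" if u: "u < 2 ^ m" for u
    proof -
      obtain x where "F x = u" using uniform_coloring_surj[OF F e u] .
      moreover obtain w where "w \<in> words n 2" "\<forall>i<n. support w i = x i" using word by blast
      ultimately show ?thesis using F_cong by metis
    qed
    have "b > 0" using b by (rule odd_pos)
    \<comment> \<open>Color 0 lies below \<open>b\<close> because \<open>b\<close> is odd, and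
      \<open>b\<close> itself is a color of the rest because \<open>c > 0\<close>.\<close>
    obtain w w' where "w \<in> words n 2" "F (support w) = 0" "w' \<in> words n 2" "F (support w') = b"
      using *[of 0] *[of b] bc by auto
    then have "f w = 1" "f w' = 0" using \<open>b > 0\<close> by (simp_all add: f_def)
    with \<open>w \<in> words n 2\<close> \<open>w' \<in> words n 2\<close> have "{0, 1} \<subseteq> f ` words n 2"
      by (metis empty_subsetI image_eqI insert_subset)
    moreover have "f ` words n 2 \<subseteq> {0, 1}" by (auto simp: f_def)
    ultimately show ?thesis by blast
  qed
  moreover have "int (card {y. (w, y) \<in> parcs (hamming_graph n 2) \<and> f y = j})
      = matrix2 (int n - int (e * b)) (int (e * b)) (int (e * c)) (int n - int (e * c)) (f w) j"
    if w: "w \<in> words n 2" and j: "j \<in> {0, 1}" for w j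
  proof (cases "F (support w) < b")
    case True
    then have "f w = 1" by (simp add: f_iff)
    show ?thesis
      unfolding \<open>f w = 1\<close> using down[OF w True] arg_cong[OF total[OF w], of int] j by (auto simp: f_iff matrix2_def)
  next
    case False
    then have "f w = 0" by (simp add: f_iff)
    show ?thesis
      unfolding \<open>f w = 0\<close> using up[OF w False] arg_cong[OF total[OF w], of int] j by (auto simp: f_iff matrix2_def)
  qed
  ultimately have "perfect_coloring (hamming_graph n 2) {0, 1} f
      (matrix2 (int n - int (e * b)) (int (e * b)) (int (e * c)) (int n - int (e * c)))"
    unfolding perfect_coloring_def by (auto simp: hamming_graph_def)
  moreover have "without_nonessential_arguments n 2 f"
    unfolding without_nonessential_arguments_def depends_essentially_def
  proof (intro allI impI)
    fix i assume i: "i < n"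
    have "{..<b} \<subseteq> {..<2 ^ m}" "odd (card {..<b})" using bc b by auto
    from uniform_coloring_essential[OF F i this]
    obtain x where "(F x \<in> {..<b}) \<noteq> (F (flip i x) \<in> {..<b})" .
    then have x: "(F x < b) \<noteq> (F (flip i x) < b)" by simp
    obtain w where w: "w \<in> words n 2" "\<forall>i<n. support w i = x i" using word by blast
    define y where "y = w[i := 1 - w ! i]"
    have "support y = flip i (support w)"
      unfolding y_def using support_flip[OF w(1) i] .
    then have "F (support w) = F x" "F (support y) = F (flip i x)"
      using w i by (auto simp: flip_apply intro!: F_cong)
    with x have "f w \<noteq> f y" by (simp add: f_def)
    moreover have "(w, y) \<in> parcs (hamming_graph n 2)"
      unfolding y_def using hamming_neighbors[OF w(1)] i by blast
    then have "y \<in> words n 2" by (simp add: hamming_graph_def)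
    moreover have "{j. j < n \<and> w ! j \<noteq> y ! j} = {i}"
      using w i words_2_nth[OF w(1) i] by (auto simp: y_def words_def nth_list_update)
    ultimately show "\<exists>x\<in>words n 2. \<exists>y\<in>words n 2. {j. j < n \<and> x ! j \<noteq> y ! j} = {i} \<and> f x \<noteq> f y"
      using w(1) by blast
  qed
  ultimately show ?thesis by blast
qed

section \<open>Choice of parameters for both claims\<close>

theorem theorem2:
  fixes b c e M :: nat
  assumes "b > 0" and "c > 0"
    and "e = gcd b c"
    and "M = (b + c) div e"
  shows "((\<exists>m. M = 2 ^ m) \<longrightarrow>
           (let N = (2 * M - 1) * 2 ^ (e - 1) - M in
            \<exists>f. perfect_coloring (hamming_graph N 2) {0, 1} f
                  (matrix2 (int N - int b) (int b) (int c) (int N - int c)) \<and>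
                without_nonessential_arguments N 2 f))
       \<and> (M \<ge> 8 \<and> (\<exists>m. odd m \<and> M = 2 ^ m) \<longrightarrow>
           (let N = M * 2 ^ e - M in
            \<exists>f. perfect_coloring (hamming_graph N 2) {0, 1} f
                  (matrix2 (int N - int b) (int b) (int c) (int N - int c)) \<and>
                without_nonessential_arguments N 2 f))"
proof -
  have e: "e > 0" using assms by simp
  obtain b' c' where bc: "b = e * b'" "c = e * c'" "coprime b' c'"
    using gcd_coprime_exists[of b c] e unfolding assms(3) by (metis mult.commute not_gr_zero)
  have M: "M = b' + c'"
    using assms(4) e by (simp add: bc flip: distrib_left)
  have pos: "b' > 0" "c' > 0" using assms(1,2) bc by auto
  \<comment> \<open>Common to both claims: a base coloring of dimension \<open>n = M - 1\<close>
    gives the factor \<open>2 * M - 1\<close>, and \<open>n = M\<close> gives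
    \<open>2 * M * 2 ^ (e - 1) = M * 2 ^ e\<close>.\<close>
  have merge: "\<exists>f. perfect_coloring (hamming_graph N 2) {0, 1} f
        (matrix2 (int N - int b) (int b) (int c) (int N - int c)) \<and>
      without_nonessential_arguments N 2 f"
    if m: "M = 2 ^ m" and F: "uniform_coloring m n 1 F" and N: "N = (n + M) * 2 ^ (e - 1) - M"
    for m n F N
  proof -
    \<comment> \<open>As \<open>b'\<close> and \<open>c'\<close> are positive,
      \<open>M \<ge> 2\<close>; so their sum is even, and being coprime they are both odd.\<close>
    have "m > 0" using m M pos by (cases m) auto
    then have "even (b' + c')" using m M by (metis even_power even_numeral)
    then have "odd b'" using bc(3) by (metis coprime_common_divisor even_add odd_one)
    obtain k G where "uniform_coloring m k e G" "k + M = (n + M) * 2 ^ (e - 1)"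
      using uniform_coloring_iterate[OF F \<open>m > 0\<close> e] m by blast
    then have "uniform_coloring m N e G" using N by (metis add_diff_cancel_right')
    from uniform_coloring_merge[OF this e \<open>odd b'\<close> _ pos(2)] m M
    show ?thesis by (simp add: bc)
  qed
  show ?thesis
    unfolding Let_def
  proof (intro conjI impI; (elim conjE)?)
    assume "\<exists>m. M = 2 ^ m"
    then obtain m where m: "M = 2 ^ m" ..
    have "2 * M - 1 = 2 ^ m - 1 + M" using m by simp
    then show "\<exists>f. perfect_coloring (hamming_graph ((2 * M - 1) * 2 ^ (e - 1) - M) 2) {0, 1} f
        (matrix2 (int ((2 * M - 1) * 2 ^ (e - 1) - M) - int b) (int b) (int c)
          (int ((2 * M - 1) * 2 ^ (e - 1) - M) - int c)) \<and>
        without_nonessential_arguments ((2 * M - 1) * 2 ^ (e - 1) - M) 2 f"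
      by (intro merge[OF m uniform_coloring_hamming]) simp
  next
    assume M8: "M \<ge> 8" and "\<exists>m. odd m \<and> M = 2 ^ m"
    then obtain m where m: "M = 2 ^ m" by blast
    have "(2::nat) ^ 3 \<le> 2 ^ m" using M8 m by simp
    then have "m \<ge> 3" by (rule power_le_imp_le_exp[rotated]) simp
    moreover have "M * 2 ^ e = (2 ^ m + M) * 2 ^ (e - 1)"
      using m e by (cases e) simp_all
    ultimately show "\<exists>f. perfect_coloring (hamming_graph (M * 2 ^ e - M) 2) {0, 1} f
        (matrix2 (int (M * 2 ^ e - M) - int b) (int b) (int c) (int (M * 2 ^ e - M) - int c)) \<and>
        without_nonessential_arguments (M * 2 ^ e - M) 2 f"
      by (intro merge[OF m uniform_coloring_twisted]) simp_all
  qed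
qed

end
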